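(* Consider the recursive distributional equation $$X\overset{D}{=}\min_{j\ge1}(\xi_j-X_j)^+,$$ for probability distributions on $[0,\infty)$. Its unique solution is the distribution whose c.d.f. $F_*$ has complementary c.d.f. $\overline{F}_*=1-F_*$ given by $$\overline{F}_*(y)=\begin{cases}W(1)e^{-y},& y\ge0,\\ 1,& y<0.\end{cases}$$
   Context: In the equation, $X_1,X_2,\dots$ are i.i.d. $[0,\infty)$-valued random variables with the same distribution as $X$, and $0<\xi_1<\xi_2<\cdots$ are the points of a Poisson process of rate $1$ on $[0,\infty)$, independent of $(X_j)_{j\ge1}$. A solution is a probability distribution on $[0,\infty)$ which, when taken as the common distribution of $X,X_1,X_2,\dots$, makes the two sides equal in distribution. $x^+=\max\{x,0\}$. $W$ is Lambert's $W$-function on $[0,\infty)$, the inverse of $x\mapsto xe^x$; $W(1)e^{W(1)}=1$. *)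

theory Defs
  imports "HOL-Probability.Probability"
begin

text \<open>
  The points \<open>\<xi>\<^sub>1 < \<xi>\<^sub>2 < \<dots>\<close> of a rate-one Poisson process are numbered from \<open>0\<close> here.
  Local finiteness (\<open>locally_finite\<close>) makes every counting variable almost surely
  finite, so that \<^const>\<open>card\<close> never takes its default value for infinite sets, up to a null event.
\<close>

definition count_points :: "(nat \<Rightarrow> 'a \<Rightarrow> real) \<Rightarrow> real \<Rightarrow> real \<Rightarrow> 'a \<Rightarrow> nat" where
  "count_points \<xi> s t \<omega> = card {j. s < \<xi> j \<omega> \<and> \<xi> j \<omega> \<le> t}"

locale poisson_points = prob_space M for M :: "'a measure" +
  fixes \<xi> :: "nat \<Rightarrow> 'a \<Rightarrow> real"
  assumes random_points: "\<And>j. random_variable borel (\<xi> j)"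
    and points_pos: "AE \<omega> in M. 0 < \<xi> 0 \<omega>"
    and points_increasing: "AE \<omega> in M. strict_mono (\<lambda>j. \<xi> j \<omega>)"
    and locally_finite: "AE \<omega> in M. \<forall>t. finite {j. \<xi> j \<omega> \<le> t}"
    and indep_increments:
      "\<And>(t :: nat \<Rightarrow> real) n. 0 \<le> t 0 \<Longrightarrow> strict_mono t \<Longrightarrow>
         indep_vars (\<lambda>_. count_space UNIV) (\<lambda>i. count_points \<xi> (t i) (t (Suc i))) {..<n}"
    and poisson_increments:
      "\<And>s t. 0 \<le> s \<Longrightarrow> s < t \<Longrightarrow>
         distr M (count_space UNIV) (count_points \<xi> s t) = measure_pmf (poisson_pmf (t - s))"

text \<open>
  The law of \<open>min\<^sub>j (\<xi>\<^sub>j - X\<^sub>j)\<^sup>+\<close>: the \<open>X\<^sub>j\<close> are the coordinates of the infinite product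
  of copies of \<open>\<mu>\<close>, hence i.i.d. with law \<open>\<mu>\<close>, and are independent of \<open>\<xi>\<close> by the outer product.
  The infimum is over reals bounded below by \<open>0\<close>, and it equals the minimum whenever the latter
  exists. For i.i.d. nonnegative \<open>X\<^sub>j\<close> this is almost surely the case: if \<open>X\<close> has finite mean then
  \<open>\<xi>\<^sub>j - X\<^sub>j\<close> tends to infinity, and otherwise some term is \<open>0\<close>.
\<close>

definition rde_rhs :: "'a measure \<Rightarrow> (nat \<Rightarrow> 'a \<Rightarrow> real) \<Rightarrow> real measure \<Rightarrow> real measure" where
  "rde_rhs M \<xi> \<mu> =
     distr (M \<Otimes>\<^sub>M (\<Pi>\<^sub>M j\<in>(UNIV :: nat set). \<mu>)) borel
       (\<lambda>(\<omega>, X). INF j. max (\<xi> j \<omega> - X j) 0)"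

definition rde_solution :: "'a measure \<Rightarrow> (nat \<Rightarrow> 'a \<Rightarrow> real) \<Rightarrow> real measure \<Rightarrow> bool" where
  "rde_solution M \<xi> \<mu> \<longleftrightarrow>
     real_distribution \<mu> \<and> (AE x in \<mu>. 0 \<le> x) \<and> \<mu> = rde_rhs M \<xi> \<mu>"

definition lambert_W :: "real \<Rightarrow> real" where
  "lambert_W = the_inv_into {0..} (\<lambda>x. x * exp x)"

end

theory Submission
  imports Defs
begin

text \<open>
  The pairs \<open>(\<xi>\<^sub>j, X\<^sub>j)\<close> form a marked Poisson process, so for \<open>y > 0\<close> the probability that no
  \<open>\<xi>\<^sub>j - X\<^sub>j\<close> is below \<open>y\<close> is \<open>exp (- \<integral> P (X > t - y) dt) = exp (- y) * C\<close>, where the integral is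
  over \<open>t \<ge> 0\<close> and \<open>C = exp (- E X)\<close>.
  Hence every image under the map has complementary c.d.f. \<open>C * exp (- y)\<close>; a law of this form has
  mean \<open>C\<close>, so a fixed point satisfies \<open>C = exp (- C)\<close>, that is \<open>C = W(1)\<close>. Conversely, the image of
  the point mass at \<open>W(1)\<close> has the right complementary c.d.f. and is therefore fixed.
\<close>

section \<open>Poisson generating function and bounds on a grid\<close>

lemma prod_le_prod_subset:
  fixes f :: "'b \<Rightarrow> real"
  assumes "finite B" "A \<subseteq> B" "\<And>j. j \<in> B \<Longrightarrow> 0 \<le> f j" "\<And>j. j \<in> B \<Longrightarrow> f j \<le> 1"
  shows "prod f B \<le> prod f A"
proof -
  have "prod f B = prod f (B - A) * prod f A"
    using assms(1,2) by (simp add: prod.subset_diff mult.commute)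
  also have "\<dots> \<le> prod f A"
    using assms by (intro mult_left_le_one_le prod_nonneg prod_le_1) auto
  finally show ?thesis .
qed

text \<open>Weighting \<open>a ^ k\<close> by the Poisson probabilities gives the exponential series
  at \<open>r * a\<close>, damped by \<open>exp (- r)\<close>. This is how products over random
  points become exponentials.\<close>

lemma expectation_power_poisson:
  fixes r a :: real
  assumes "0 < r" "0 \<le> a"
  shows "integrable (measure_pmf (poisson_pmf r)) (\<lambda>k. a ^ k)"
    and "measure_pmf.expectation (poisson_pmf r) (\<lambda>k. a ^ k) = exp (- (r * (1 - a)))"
proof -
  have "(\<lambda>k. (r * a) ^ k /\<^sub>R fact k) sums exp (r * a)"
    by (rule exp_converges)
  then have "(\<lambda>k. (r * a) ^ k /\<^sub>R fact k * exp (- r)) sums (exp (r * a) * exp (- r))"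
    by (rule sums_mult2)
  then have s: "(\<lambda>k. r ^ k / fact k * exp (- r) * a ^ k) sums exp (- (r * (1 - a)))"
    by (simp add: power_mult_distrib divide_inverse ac_simps exp_add[symmetric] algebra_simps)
  have "(\<integral>\<^sup>+k. ennreal (a ^ k) \<partial>measure_pmf (poisson_pmf r))
      = (\<integral>\<^sup>+k. ennreal (r ^ k / fact k * exp (- r) * a ^ k) \<partial>count_space UNIV)"
    using assms by (simp add: nn_integral_measure_pmf ennreal_mult[symmetric] ac_simps)
  also have "\<dots> = ennreal (exp (- (r * (1 - a))))"
    using assms by (simp only: nn_integral_count_space_nat) (intro suminf_ennreal_eq s, simp)
  finally have *: "(\<integral>\<^sup>+k. ennreal (a ^ k) \<partial>measure_pmf (poisson_pmf r)) = ennreal (exp (- (r * (1 - a))))" .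
  show "integrable (measure_pmf (poisson_pmf r)) (\<lambda>k. a ^ k)"
    using assms * by (intro integrableI_nonneg) auto
  show "measure_pmf.expectation (poisson_pmf r) (\<lambda>k. a ^ k) = exp (- (r * (1 - a)))"
    using assms * by (intro integral_eq_nn_integral[THEN trans]) auto
qed

text \<open>By induction over the cells: as \<open>g\<close> is monotone, each point contributes a
  factor between the values of \<open>g\<close> at the two ends of its cell. The cells are left-open
  and right-closed as in \<open>count_points\<close>, so the bounds are powers of counts whose joint
  law is known.\<close>

lemma prod_grid_bounds:
  fixes x :: "nat \<Rightarrow> real" and g :: "real \<Rightarrow> real"
  assumes "0 < \<delta>" "\<And>t. finite {j. x j \<le> t}" "mono g" "\<And>t. 0 \<le> g t"
  defines "N \<equiv> \<lambda>i. card {j. real i * \<delta> < x j \<and> x j \<le> real (Suc i) * \<delta>}"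
  shows "(\<Prod>i<n. g (real i * \<delta>) ^ N i) \<le> (\<Prod>j | 0 < x j \<and> x j \<le> real n * \<delta>. g (x j))" (is "?lower n")
    and "(\<Prod>j | 0 < x j \<and> x j \<le> real n * \<delta>. g (x j)) \<le> (\<Prod>i<n. g (real (Suc i) * \<delta>) ^ N i)" (is "?upper n")
proof -
  have "?lower n \<and> ?upper n"
  proof (induction n)
    case 0
    have "{j. 0 < x j \<and> x j \<le> 0} = {}" by auto
    then show ?case by (simp only: of_nat_0 mult_zero_left) simp
  next
    case (Suc n)
    let ?A = "{j. real n * \<delta> < x j \<and> x j \<le> real (Suc n) * \<delta>}"
    let ?B = "{j. 0 < x j \<and> x j \<le> real n * \<delta>}"
    have fin: "finite ?A" "finite ?B"
      by (rule finite_subset[OF _ assms(2)], blast)+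
    have le: "0 \<le> real n * \<delta>" "real n * \<delta> \<le> real (Suc n) * \<delta>"
      using \<open>0 < \<delta>\<close> by (auto simp: algebra_simps)
    have "{j. 0 < x j \<and> x j \<le> real (Suc n) * \<delta>} = ?B \<union> ?A"
      using le by (auto intro: less_imp_le)
    then have eq: "(\<Prod>j | 0 < x j \<and> x j \<le> real (Suc n) * \<delta>. g (x j)) = (\<Prod>j\<in>?B. g (x j)) * (\<Prod>j\<in>?A. g (x j))"
      using fin by (auto intro!: prod.union_disjoint)
    have "(\<Prod>j\<in>?A. g (real n * \<delta>)) \<le> (\<Prod>j\<in>?A. g (x j))"
      using assms(3,4) by (intro prod_mono) (auto intro: monoD)
    then have 1: "g (real n * \<delta>) ^ N n \<le> (\<Prod>j\<in>?A. g (x j))"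
      by (simp add: N_def)
    have "(\<Prod>j\<in>?A. g (x j)) \<le> (\<Prod>j\<in>?A. g (real (Suc n) * \<delta>))"
      using assms(3,4) by (intro prod_mono) (auto intro: monoD)
    then have 2: "(\<Prod>j\<in>?A. g (x j)) \<le> g (real (Suc n) * \<delta>) ^ N n"
      by (simp add: N_def)
    show ?case
      unfolding eq prod.lessThan_Suc using Suc.IH 1 2 assms(4)
      by (auto intro!: mult_mono prod_nonneg zero_le_power)
  qed
  then show "?lower n" "?upper n" by auto
qed

lemma antimono_integrable_on_interval:
  fixes h :: "real \<Rightarrow> real"
  assumes "antimono h"
  shows "h integrable_on {a..b}"
proof -
  have "(\<lambda>x. - h x) integrable_on {a..b}"
    using assms by (intro integrable_on_mono_on) (auto simp: monotone_on_def)
  then show ?thesis by (simp add: integrable_neg_iff)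
qed

text \<open>Endpoint sums of this kind appear as exponents in
  \<open>expectation_prod_counts\<close>; here they are compared with the integral, one cell at a
  time.\<close>

lemma grid_sum_bounds:
  fixes h :: "real \<Rightarrow> real"
  assumes "0 < \<delta>" "antimono h"
  shows "(\<Sum>i<n. h (real (Suc i) * \<delta>)) * \<delta> \<le> integral {0..real n * \<delta>} h"
    and "integral {0..real n * \<delta>} h \<le> (\<Sum>i<n. h (real i * \<delta>)) * \<delta>"
proof -
  note int = antimono_integrable_on_interval[OF assms(2)]
  have "(\<Sum>i<n. h (real (Suc i) * \<delta>)) * \<delta> \<le> integral {0..real n * \<delta>} h \<and>
        integral {0..real n * \<delta>} h \<le> (\<Sum>i<n. h (real i * \<delta>)) * \<delta>"
  proof (induction n)
    case (Suc n)
    let ?a = "real n * \<delta>" and ?b = "real (Suc n) * \<delta>"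
    have le: "0 \<le> ?a" "?a \<le> ?b" and len: "?b - ?a = \<delta>"
      using \<open>0 < \<delta>\<close> by (auto simp: algebra_simps)
    have "integral {0..?a} h + integral {?a..?b} h = integral {0..?b} h"
      using le by (intro Henstock_Kurzweil_Integration.integral_combine int)
    moreover have "integral {?a..?b} (\<lambda>_. h ?b) \<le> integral {?a..?b} h"
      using assms(2) by (intro integral_le int) (auto intro: antimonoD)
    moreover have "integral {?a..?b} h \<le> integral {?a..?b} (\<lambda>_. h ?a)"
      using assms(2) by (intro integral_le int) (auto intro: antimonoD)
    ultimately show ?case
      using Suc.IH le by (simp add: len algebra_simps)
  qed simp
  then show "(\<Sum>i<n. h (real (Suc i) * \<delta>)) * \<delta> \<le> integral {0..real n * \<delta>} h"
    "integral {0..real n * \<delta>} h \<le> (\<Sum>i<n. h (real i * \<delta>)) * \<delta>" by auto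
qed

section \<open>The probability generating functional of the process\<close>

context poisson_points
begin

text \<open>Measurability is extracted from \<open>indep_vars\<close>, which contains it; an
  equation about \<open>distr\<close> alone would not provide it.\<close>

lemma count_points_measurable:
  assumes "0 \<le> s" "s < t"
  shows "count_points \<xi> s t \<in> measurable M (count_space UNIV)"
proof -
  \<comment> \<open>\<open>indep_increments\<close> asks for an infinite increasing sequence, so the
    pair is extended to a progression with \<open>u 0 = s\<close> and
    \<open>u 1 = t\<close>.\<close>
  define u where "u i = s + real i * (t - s)" for i
  have "indep_vars (\<lambda>_. count_space UNIV) (\<lambda>i. count_points \<xi> (u i) (u (Suc i))) {..<1}"
    using assms by (intro indep_increments) (auto simp: u_def strict_mono_def)
  then show ?thesis
    by (auto simp: indep_vars_def u_def)
qed

text \<open>Counts in disjoint cells are independent, so the expectation factorises into values of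
  the Poisson generating function with parameter \<open>\<delta>\<close>.\<close>

lemma expectation_prod_counts:
  fixes a :: "nat \<Rightarrow> real"
  assumes "0 < \<delta>" "\<And>i. 0 \<le> a i"
  shows "expectation (\<lambda>\<omega>. \<Prod>i<n. a i ^ count_points \<xi> (real i * \<delta>) (real (Suc i) * \<delta>) \<omega>)
       = exp (- ((\<Sum>i<n. 1 - a i) * \<delta>))"
proof -
  let ?N = "\<lambda>i. count_points \<xi> (real i * \<delta>) (real (Suc i) * \<delta>)"
  have lt: "0 \<le> real i * \<delta>" "real i * \<delta> < real (Suc i) * \<delta>" for i
    using \<open>0 < \<delta>\<close> by (auto simp: algebra_simps)
  have meas: "?N i \<in> measurable M (count_space UNIV)" for i
    by (rule count_points_measurable[OF lt])
  have law: "distr M (count_space UNIV) (?N i) = measure_pmf (poisson_pmf \<delta>)" for i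
    using poisson_increments[OF lt] by (simp add: algebra_simps)
  have int: "integrable M (\<lambda>\<omega>. a i ^ ?N i \<omega>)" for i
    using integrable_distr[OF meas[of i], of "\<lambda>k. a i ^ k"] expectation_power_poisson(1)[OF assms(1) assms(2)[of i]]
    unfolding law by simp
  have E: "expectation (\<lambda>\<omega>. a i ^ ?N i \<omega>) = exp (- (\<delta> * (1 - a i)))" for i
    using integral_distr[OF meas[of i], of "\<lambda>k. a i ^ k"] expectation_power_poisson(2)[OF assms(1) assms(2)[of i]]
    unfolding law by simp
  have "indep_vars (\<lambda>_. count_space UNIV) ?N {..<n}"
    using \<open>0 < \<delta>\<close> by (intro indep_increments[of "\<lambda>i. real i * \<delta>"]) (auto simp: strict_mono_def)
  then have "indep_vars (\<lambda>_. borel) (\<lambda>i \<omega>. a i ^ ?N i \<omega>) {..<n}"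
    by (rule indep_vars_compose2) simp
  then have "expectation (\<lambda>\<omega>. \<Prod>i<n. a i ^ ?N i \<omega>) = (\<Prod>i<n. exp (- (\<delta> * (1 - a i))))"
    using int by (subst indep_vars_lebesgue_integral) (simp_all add: E del: of_nat_Suc)
  also have "\<dots> = exp (- ((\<Sum>i<n. 1 - a i) * \<delta>))"
    by (simp add: exp_sum[symmetric] sum_negf sum_distrib_left mult.commute)
  finally show ?thesis .
qed

text \<open>All factors are at most 1, so keeping only the points inside the grid can only increase
  the product. These are finitely many, and every sufficiently long partial product contains them
  all.\<close>

lemma prod_points_le_prod_counts:
  fixes g :: "real \<Rightarrow> real"
  assumes "0 < \<delta>" "mono g" "\<And>t. 0 \<le> g t" "\<And>t. g t \<le> 1"
    and fin: "\<forall>t. finite {j. \<xi> j \<omega> \<le> t}"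
    and lim: "(\<lambda>n. \<Prod>j\<le>n. g (\<xi> j \<omega>)) \<longlonglongrightarrow> p"
  shows "p \<le> (\<Prod>i<n. g (real (Suc i) * \<delta>) ^ count_points \<xi> (real i * \<delta>) (real (Suc i) * \<delta>) \<omega>)"
proof -
  let ?A = "{j. 0 < \<xi> j \<omega> \<and> \<xi> j \<omega> \<le> real n * \<delta>}"
  have "finite ?A"
    by (rule finite_subset[OF _ fin[rule_format, of "real n * \<delta>"]]) auto
  then obtain K where "?A \<subseteq> {..K}"
    using finite_nat_set_iff_bounded_le by auto
  then have "(\<Prod>j\<le>k. g (\<xi> j \<omega>)) \<le> (\<Prod>j\<in>?A. g (\<xi> j \<omega>))" if "K \<le> k" for k
    using that assms(3,4) by (intro prod_le_prod_subset) auto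
  then have "p \<le> (\<Prod>j\<in>?A. g (\<xi> j \<omega>))"
    by (intro LIMSEQ_le_const2[OF lim]) blast
  also have "\<dots> \<le> (\<Prod>i<n. g (real (Suc i) * \<delta>) ^ count_points \<xi> (real i * \<delta>) (real (Suc i) * \<delta>) \<omega>)"
    unfolding count_points_def
    using prod_grid_bounds(2)[where x = "\<lambda>j. \<xi> j \<omega>"] assms(1-3) fin by blast
  finally show ?thesis .
qed

text \<open>For a single \<open>n\<close> the step product ignores the points beyond the grid and
  need not lie below \<open>p\<close>. The infimum does, since each partial product over points
  dominates the step product of some long enough grid.\<close>

lemma INF_prod_counts_le_prod_points:
  fixes g :: "real \<Rightarrow> real"
  assumes "0 < \<delta>" "mono g" "\<And>t. 0 \<le> g t" "\<And>t. g t \<le> 1"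
    and fin: "\<forall>t. finite {j. \<xi> j \<omega> \<le> t}" and pos: "\<And>j. 0 < \<xi> j \<omega>"
    and lim: "(\<lambda>n. \<Prod>j\<le>n. g (\<xi> j \<omega>)) \<longlonglongrightarrow> p"
  shows "(INF n. \<Prod>i<n. g (real i * \<delta>) ^ count_points \<xi> (real i * \<delta>) (real (Suc i) * \<delta>) \<omega>) \<le> p"
    (is "(INF n. ?S n) \<le> p")
proof -
  have bdd: "bdd_below (range ?S)"
    using assms(3) by (intro bdd_belowI[of _ 0]) (auto intro!: prod_nonneg)
  have "(INF n. ?S n) \<le> (\<Prod>j\<le>k. g (\<xi> j \<omega>))" for k
  proof -
    \<comment> \<open>The grid is taken long enough to contain the first \<open>k + 1\<close>
      points.\<close>
    obtain n :: nat where n: "Max ((\<lambda>j. \<xi> j \<omega>) ` {..k}) \<le> real n * \<delta>"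
      using \<open>0 < \<delta>\<close> by (meson reals_Archimedean3 less_imp_le)
    let ?A = "{j. 0 < \<xi> j \<omega> \<and> \<xi> j \<omega> \<le> real n * \<delta>}"
    have sub: "{..k} \<subseteq> ?A"
      using n pos by auto
    have "finite ?A"
      by (rule finite_subset[OF _ fin[rule_format, of "real n * \<delta>"]]) auto
    have "(INF n. ?S n) \<le> ?S n"
      by (rule cINF_lower[OF bdd]) simp
    also have "\<dots> \<le> (\<Prod>j\<in>?A. g (\<xi> j \<omega>))"
      unfolding count_points_def
      using prod_grid_bounds(1)[where x = "\<lambda>j. \<xi> j \<omega>"] assms(1-3) fin by blast
    also have "\<dots> \<le> (\<Prod>j\<le>k. g (\<xi> j \<omega>))"
      using \<open>finite ?A\<close> sub assms(3,4) by (intro prod_le_prod_subset) auto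
    finally show ?thesis .
  qed
  then show ?thesis
    by (intro LIMSEQ_le_const[OF lim]) blast
qed

text \<open>
  The probability generating functional of the process, for monotone \<open>g\<close>: \<open>g\<close> is sandwiched
  between step functions on a grid of mesh \<open>\<delta>\<close>. Stating the right-hand side as a limit
  covers the case where \<open>1 - g\<close> is not integrable, in which the expectation is \<open>0\<close>.
\<close>

lemma expectation_prod_points:
  fixes g :: "real \<Rightarrow> real" and P :: "'a \<Rightarrow> real"
  assumes g: "mono g" "\<And>t. 0 \<le> g t" "\<And>t. g t \<le> 1"
    and P: "P \<in> borel_measurable M" "AE \<omega> in M. (\<lambda>n. \<Prod>j\<le>n. g (\<xi> j \<omega>)) \<longlonglongrightarrow> P \<omega>"
  shows "((\<lambda>T. exp (- integral {0..T} (\<lambda>t. 1 - g t))) \<longlongrightarrow> expectation P) at_top"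
proof -
  define h where "h t = 1 - g t" for t
  define J where "J T = integral {0..T} h" for T
  define N where "N \<delta> i = count_points \<xi> (real i * \<delta>) (real (Suc i) * \<delta>)" for \<delta> i
  have h: "antimono h" "\<And>t. 0 \<le> h t" "\<And>t. h t \<le> 1"
    using g by (auto simp: h_def monotone_on_def)
  have N_meas: "N \<delta> i \<in> measurable M (count_space UNIV)" if "0 < \<delta>" for \<delta> i
    using that by (auto simp: N_def algebra_simps intro!: count_points_measurable)
  have step_meas: "(\<lambda>\<omega>. \<Prod>i<n. a i ^ N \<delta> i \<omega>) \<in> borel_measurable M" if "0 < \<delta>" for \<delta> n and a :: "nat \<Rightarrow> real"
  proof (intro borel_measurable_prod)
    fix i
    have "(\<lambda>k. a i ^ k) \<circ> N \<delta> i \<in> borel_measurable M"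
      by (rule measurable_comp[OF N_meas[OF that]]) simp
    then show "(\<lambda>\<omega>. a i ^ N \<delta> i \<omega>) \<in> borel_measurable M"
      by (simp add: comp_def)
  qed
  have step_int: "integrable M (\<lambda>\<omega>. \<Prod>i<n. a i ^ N \<delta> i \<omega>)"
    if "0 < \<delta>" "\<And>i. 0 \<le> a i" "\<And>i. a i \<le> 1" for \<delta> n and a :: "nat \<Rightarrow> real"
    using that by (intro integrable_const_bound[where B = 1] step_meas)
      (auto simp: abs_prod intro!: prod_le_1 power_le_one)
  have J_mono: "J S \<le> J T" if "S \<le> T" for S T
    unfolding J_def using that h by (intro integral_subset_le antimono_integrable_on_interval) auto
  have AE_P: "AE \<omega> in M. 0 \<le> P \<omega> \<and> P \<omega> \<le> 1"
    using P(2)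
  proof eventually_elim
    case (elim \<omega>)
    then show ?case
      using g by (auto intro!: LIMSEQ_le_const[OF elim] LIMSEQ_le_const2[OF elim] exI[of _ 0]
          prod_nonneg prod_le_1)
  qed
  have P_int: "integrable M P"
    using AE_P P(1) by (intro integrable_const_bound[where B = 1]) auto
  have EP: "0 \<le> expectation P"
    using AE_P by (intro integral_nonneg_AE) auto
  \<comment> \<open>The two endpoint sums differ by \<open>h 0 - h (real n * \<delta>)\<close>,
    which is at most 1. After scaling by the mesh this is the error \<open>\<delta>\<close> in the
    exponents of \<open>upper\<close> and \<open>lower\<close>.\<close>
  have sum_shift: "(\<Sum>i<n. h (real i * \<delta>)) \<le> 1 + (\<Sum>i<n. h (real (Suc i) * \<delta>))" for n \<delta>
  proof -
    have "(\<Sum>i<n. h (real i * \<delta>)) + h (real n * \<delta>) = h 0 + (\<Sum>i<n. h (real (Suc i) * \<delta>))"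
      using sum.lessThan_Suc_shift[of "\<lambda>i. h (real i * \<delta>)" n] by simp
    then show ?thesis
      using h(2)[of "real n * \<delta>"] h(3)[of 0] by linarith
  qed
  have upper: "expectation P \<le> exp (\<delta> - J (real n * \<delta>))" if "0 < \<delta>" for \<delta> n
  proof -
    have "expectation P \<le> expectation (\<lambda>\<omega>. \<Prod>i<n. g (real (Suc i) * \<delta>) ^ N \<delta> i \<omega>)"
    proof (rule integral_mono_AE[OF P_int step_int])
      show "AE \<omega> in M. P \<omega> \<le> (\<Prod>i<n. g (real (Suc i) * \<delta>) ^ N \<delta> i \<omega>)"
        using P(2) locally_finite
        unfolding N_def by eventually_elim (rule prod_points_le_prod_counts[OF that g])
    qed (use that g in auto)
    also have "\<dots> = exp (- ((\<Sum>i<n. h (real (Suc i) * \<delta>)) * \<delta>))"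
      unfolding N_def h_def using that g(2) by (rule expectation_prod_counts)
    also have "\<dots> \<le> exp (\<delta> - J (real n * \<delta>))"
      using grid_sum_bounds(2)[OF that h(1), of n] mult_right_mono[OF sum_shift[of \<delta> n], of \<delta>] that
      by (simp add: J_def algebra_simps)
    finally show ?thesis .
  qed
  \<comment> \<open>With mesh \<open>T / real (Suc n)\<close> the grid ends exactly at
    \<open>T\<close>; the error vanishes as the mesh is refined.\<close>
  have upper': "expectation P \<le> exp (- J T)" if "0 < T" for T
  proof -
    have "expectation P \<le> exp (T / real (Suc n) - J T)" for n
      using upper[of "T / real (Suc n)" "Suc n"] that by simp
    moreover have "(\<lambda>n. exp (T / real (Suc n) - J T)) \<longlonglongrightarrow> exp (0 - J T)"
      by (intro tendsto_intros LIMSEQ_Suc lim_const_over_n)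
    ultimately show ?thesis
      by (intro LIMSEQ_le_const) auto
  qed
  \<comment> \<open>Here the mesh is fixed and the grid grows: the step products decrease to their
    infimum, which is almost surely below \<open>P\<close>, and dominated convergence carries this
    over to expectations.\<close>
  have lower: "\<exists>n. exp (- \<delta> - J (real n * \<delta>)) < b" if "0 < \<delta>" "expectation P < b" for \<delta> b
  proof -
    let ?S = "\<lambda>n \<omega>. \<Prod>i<n. g (real i * \<delta>) ^ N \<delta> i \<omega>"
    have S01: "0 \<le> ?S n \<omega>" "?S n \<omega> \<le> 1" for n \<omega>
      using g by (auto intro!: prod_nonneg prod_le_1 power_le_one)
    have S_norm: "norm (?S n \<omega>) \<le> 1" for n \<omega>
      using S01 by (simp only: real_norm_def abs_of_nonneg)
    have lim: "(\<lambda>n. ?S n \<omega>) \<longlonglongrightarrow> (INF n. ?S n \<omega>)" for \<omega>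
    proof (rule LIMSEQ_decseq_INF)
      show "bdd_below (range (\<lambda>n. ?S n \<omega>))"
        using S01 by (auto intro!: bdd_belowI[of _ 0])
      show "decseq (\<lambda>n. ?S n \<omega>)"
        using g S01 by (intro decseq_SucI) (auto intro!: mult_right_le_one_le power_le_one)
    qed
    have INF_meas: "(\<lambda>\<omega>. INF n. ?S n \<omega>) \<in> borel_measurable M"
      by (rule borel_measurable_LIMSEQ_real[OF lim step_meas[OF that(1)]])
    have dom: "AE \<omega> in M. (\<lambda>n. ?S n \<omega>) \<longlonglongrightarrow> (INF n. ?S n \<omega>)"
      "\<And>n. AE \<omega> in M. norm (?S n \<omega>) \<le> 1"
      by (rule AE_I2, rule lim, rule AE_I2, rule S_norm)
    have conv: "(\<lambda>n. expectation (?S n)) \<longlonglongrightarrow> expectation (\<lambda>\<omega>. INF n. ?S n \<omega>)"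
      by (rule integral_dominated_convergence[where w = "\<lambda>_. 1", OF INF_meas step_meas[OF that(1)] _ dom]) simp
    have "expectation (\<lambda>\<omega>. INF n. ?S n \<omega>) \<le> expectation P"
    proof (rule integral_mono_AE[OF _ P_int])
      show "integrable M (\<lambda>\<omega>. INF n. ?S n \<omega>)"
        by (rule integrable_dominated_convergence[where w = "\<lambda>_. 1", OF INF_meas step_meas[OF that(1)] _ dom]) simp
      show "AE \<omega> in M. (INF n. ?S n \<omega>) \<le> P \<omega>"
        using P(2) locally_finite points_pos points_increasing
      proof eventually_elim
        case (elim \<omega>)
        then have "0 < \<xi> j \<omega>" for j
          by (metis le0 less_le_trans strict_mono_less_eq)
        with elim show ?case
          unfolding N_def by (intro INF_prod_counts_le_prod_points[OF that(1) g])
      qed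
    qed
    with that conv have "eventually (\<lambda>n. expectation (?S n) < b) sequentially"
      by (intro order_tendstoD(2)[OF conv]) auto
    then obtain n where "expectation (?S n) < b"
      by (auto simp: eventually_sequentially)
    moreover have "expectation (?S n) = exp (- ((\<Sum>i<n. h (real i * \<delta>)) * \<delta>))"
      unfolding N_def h_def using that(1) g(2) by (rule expectation_prod_counts)
    moreover have "exp (- \<delta> - J (real n * \<delta>)) \<le> exp (- ((\<Sum>i<n. h (real i * \<delta>)) * \<delta>))"
      using grid_sum_bounds(1)[OF that(1) h(1), of n] mult_right_mono[OF sum_shift[of \<delta> n], of \<delta>] that
      by (simp add: J_def algebra_simps)
    ultimately show ?thesis by (intro exI[of _ n]) linarith
  qed
  have "((\<lambda>T. exp (- J T)) \<longlongrightarrow> expectation P) at_top"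
  proof (rule order_tendstoI)
    fix a assume a: "a < expectation P"
    show "eventually (\<lambda>T. a < exp (- J T)) at_top"
      using eventually_gt_at_top[of 0] by eventually_elim (rule less_le_trans[OF a upper'])
  next
    fix a assume a: "expectation P < a"
    \<comment> \<open>The midpoint is positive and leaves a factor \<open>a / b > 1\<close> of room;
      \<open>\<delta>\<close> is chosen so that \<open>exp \<delta>\<close> uses up exactly this
      factor.\<close>
    define b where "b = (expectation P + a) / 2"
    have b: "0 < b" "b < a" "expectation P < b"
      using a EP by (auto simp: b_def)
    define \<delta> where "\<delta> = ln (a / b)"
    have "0 < \<delta>" "exp \<delta> = a / b"
      using b by (auto simp: \<delta>_def)
    obtain n where "exp (- \<delta> - J (real n * \<delta>)) < b"
      using lower[OF \<open>0 < \<delta>\<close> b(3)] by blast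
    then have "exp \<delta> * exp (- \<delta> - J (real n * \<delta>)) < exp \<delta> * b"
      by simp
    moreover have "exp \<delta> * exp (- \<delta> - J (real n * \<delta>)) = exp (- J (real n * \<delta>))"
      by (simp flip: exp_add)
    ultimately have n: "exp (- J (real n * \<delta>)) < a"
      using b \<open>exp \<delta> = a / b\<close> by simp
    \<comment> \<open>As \<open>J\<close> is nondecreasing, a bound at one grid end persists for all
      larger \<open>T\<close>.\<close>
    show "eventually (\<lambda>T. exp (- J T) < a) at_top"
      using eventually_ge_at_top[of "real n * \<delta>"]
    proof eventually_elim
      case (elim T)
      then have "exp (- J T) \<le> exp (- J (real n * \<delta>))"
        using J_mono by simp
      with n show ?case by linarith
    qed
  qed
  then show ?thesis by (simp add: J_def h_def[abs_def])
qed

end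

section \<open>Tails of real distributions\<close>

lemma (in real_distribution) cdf_eq_0_of_neg:
  assumes "AE x in M. 0 \<le> x" "y < 0"
  shows "cdf M y = 0"
proof -
  have "AE x in M. x \<notin> {..y}"
    using assms(1) by eventually_elim (use assms(2) in auto)
  then show ?thesis
    by (simp add: cdf_def prob_eq_0)
qed

text \<open>The half-lines \<open>{x..}\<close> increase to the open half-line above
  \<open>y\<close> as \<open>x\<close> decreases to \<open>y\<close>, so continuity from below
  applies. For the recursive map this reaches \<open>y = 0\<close>, where \<open>{0..}\<close>
  itself has full mass because of the truncation.\<close>

lemma (in real_distribution) one_minus_cdf_eqI:
  assumes "continuous (at_right y) f" "\<And>x. y < x \<Longrightarrow> measure M {x..} = f x"
  shows "1 - cdf M y = f y"
proof -
  have "(\<lambda>n. measure M {y + 1 / real (Suc n)..}) \<longlonglongrightarrow> measure M (\<Union>n. {y + 1 / real (Suc n)..})"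
    by (intro finite_Lim_measure_incseq) (auto simp: incseq_def intro: order_trans[rotated] frac_le)
  also have "(\<Union>n. {y + 1 / real (Suc n)..}) = UNIV - {..y}"
  proof (intro equalityI subsetI)
    fix x assume "x \<in> UNIV - {..y}"
    then obtain n where "inverse (real (Suc n)) < x - y"
      using reals_Archimedean[of "x - y"] by auto
    then show "x \<in> (\<Union>n. {y + 1 / real (Suc n)..})"
      by (auto simp: inverse_eq_divide intro!: exI[of _ n])
  qed (auto simp: not_le intro: less_le_trans[rotated])
  also have "measure M (UNIV - {..y}) = 1 - cdf M y"
    using prob_compl[of "{..y}"] by (simp add: cdf_def)
  finally have 1: "(\<lambda>n. measure M {y + 1 / real (Suc n)..}) \<longlonglongrightarrow> 1 - cdf M y" .
  have "(\<lambda>n. y + 1 / real (Suc n)) \<longlonglongrightarrow> y + 0"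
    by (intro tendsto_intros LIMSEQ_Suc lim_const_over_n)
  then have "filterlim (\<lambda>n. y + 1 / real (Suc n)) (at_right y) sequentially"
    by (simp add: filterlim_at)
  then have "(\<lambda>n. f (y + 1 / real (Suc n))) \<longlonglongrightarrow> f y"
    using assms(1) unfolding continuous_within by (rule filterlim_compose[rotated])
  with 1 show ?thesis
    using assms(2) by (intro LIMSEQ_unique[OF 1]) simp
qed

lemma sequence_space_real_distribution:
  "real_distribution \<mu> \<Longrightarrow> sequence_space \<mu>"
  by (intro sequence_space.intro product_prob_spaceI) (simp add: real_distribution_def)

section \<open>The law of the right-hand side\<close>

context poisson_points
begin

lemma rde_map_measurable:
  assumes "real_distribution \<mu>"
  shows "(\<lambda>(\<omega>, X). INF j. max (\<xi> j \<omega> - X j) 0)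
    \<in> borel_measurable (M \<Otimes>\<^sub>M (\<Pi>\<^sub>M j\<in>(UNIV :: nat set). \<mu>))"
proof -
  interpret \<mu>: real_distribution \<mu> by fact
  note random_points[measurable]
  show ?thesis by measurable
qed

lemma real_distribution_rde_rhs:
  assumes "real_distribution \<mu>"
  shows "real_distribution (rde_rhs M \<xi> \<mu>)"
proof -
  interpret S: sequence_space \<mu>
    using assms by (rule sequence_space_real_distribution)
  interpret P: pair_prob_space M "\<Pi>\<^sub>M j\<in>(UNIV :: nat set). \<mu>" ..
  show ?thesis
    unfolding rde_rhs_def using rde_map_measurable[OF assms] by (rule P.real_distribution_distr)
qed

lemma rde_rhs_nonneg:
  assumes "real_distribution \<mu>"
  shows "AE x in rde_rhs M \<xi> \<mu>. 0 \<le> x"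
  unfolding rde_rhs_def using rde_map_measurable[OF assms]
  by (subst AE_distr_iff) (auto intro!: AE_I2 cINF_greatest)

text \<open>By Fubini, the points are frozen at \<open>\<omega>\<close> and the section probability
  is averaged. Its measurability is a separate claim because \<open>expectation_prod_points\<close>
  asks for it.\<close>

lemma
  assumes "real_distribution \<mu>"
  defines "S \<equiv> \<Pi>\<^sub>M j\<in>(UNIV :: nat set). \<mu>"
  shows measurable_measure_below_points:
      "(\<lambda>\<omega>. measure S {X. \<forall>j. X j \<le> \<xi> j \<omega> - y}) \<in> borel_measurable M"
    and measure_rde_rhs_atLeast:
      "0 < y \<Longrightarrow> measure (rde_rhs M \<xi> \<mu>) {y..} = expectation (\<lambda>\<omega>. measure S {X. \<forall>j. X j \<le> \<xi> j \<omega> - y})"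
proof -
  interpret \<mu>: real_distribution \<mu> by fact
  interpret S: sequence_space \<mu>
    using assms(1) by (rule sequence_space_real_distribution)
  interpret P: pair_prob_space M S
    unfolding S_def ..
  note random_points[measurable]
  have space_S: "space S = UNIV"
    by (simp add: S_def space_PiM)
  define B where "B = {p \<in> space (M \<Otimes>\<^sub>M S). \<forall>j. snd p j \<le> \<xi> j (fst p) - y}"
  have B: "B \<in> sets (M \<Otimes>\<^sub>M S)"
  proof -
    have [measurable]: "(\<lambda>p. snd p j) \<in> borel_measurable (M \<Otimes>\<^sub>M S)" for j
      unfolding S_def by measurable
    show ?thesis
      unfolding B_def by measurable
  qed
  have sect: "Pair \<omega> -` B = {X. \<forall>j. X j \<le> \<xi> j \<omega> - y}" if "\<omega> \<in> space M" for \<omega>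
    using that by (auto simp: B_def space_pair_measure space_S)
  have "(\<lambda>\<omega>. measure S (Pair \<omega> -` B)) \<in> borel_measurable M"
    unfolding measure_def using P.M2.measurable_emeasure_Pair[OF B] by measurable
  then show meas: "(\<lambda>\<omega>. measure S {X. \<forall>j. X j \<le> \<xi> j \<omega> - y}) \<in> borel_measurable M"
    by (subst (asm) measurable_cong[OF arg_cong[OF sect]])
  show "measure (rde_rhs M \<xi> \<mu>) {y..} = expectation (\<lambda>\<omega>. measure S {X. \<forall>j. X j \<le> \<xi> j \<omega> - y})"
    if "0 < y"
  proof -
    \<comment> \<open>Since \<open>y > 0\<close>, a term that is at least \<open>y\<close> cannot
      come from the truncation at 0.\<close>
    have "y \<le> (INF j. max (\<xi> j \<omega> - X j) 0) \<longleftrightarrow> (\<forall>j. X j \<le> \<xi> j \<omega> - y)" for \<omega> X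
    proof -
      have "bdd_below (range (\<lambda>j. max (\<xi> j \<omega> - X j) 0))"
        by (auto intro!: bdd_belowI[of _ 0])
      then have "y \<le> (INF j. max (\<xi> j \<omega> - X j) 0) \<longleftrightarrow> (\<forall>j. y \<le> max (\<xi> j \<omega> - X j) 0)"
        by (simp add: le_cINF_iff)
      also have "\<dots> \<longleftrightarrow> (\<forall>j. X j \<le> \<xi> j \<omega> - y)"
        using that by (intro all_cong1) (auto simp: le_max_iff_disj)
      finally show ?thesis .
    qed
    then have "(\<lambda>(\<omega>, X). INF j. max (\<xi> j \<omega> - X j) 0) -` {y..} \<inter> space (M \<Otimes>\<^sub>M S) = B"
      by (auto simp: B_def)
    then have "measure (rde_rhs M \<xi> \<mu>) {y..} = measure (M \<Otimes>\<^sub>M S) B"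
      unfolding rde_rhs_def S_def using rde_map_measurable[OF assms(1)] by (subst measure_distr) auto
    moreover have "emeasure (M \<Otimes>\<^sub>M S) B
        = ennreal (expectation (\<lambda>\<omega>. measure S {X. \<forall>j. X j \<le> \<xi> j \<omega> - y}))"
    proof -
      have "emeasure (M \<Otimes>\<^sub>M S) B = (\<integral>\<^sup>+\<omega>. ennreal (measure S {X. \<forall>j. X j \<le> \<xi> j \<omega> - y}) \<partial>M)"
        unfolding P.M2.emeasure_pair_measure_alt[OF B]
        by (intro nn_integral_cong) (simp add: sect P.M2.emeasure_eq_measure)
      also have "\<dots> = ennreal (expectation (\<lambda>\<omega>. measure S {X. \<forall>j. X j \<le> \<xi> j \<omega> - y}))"
        using meas by (intro nn_integral_eq_integral integrable_const_bound[where B = 1]) auto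
      finally show ?thesis .
    qed
    ultimately show ?thesis
      by (simp add: measure_def integral_nonneg)
  qed
qed

text \<open>For frozen points the \<open>X j\<close> are independent, so the section probability is
  the infinite product of \<open>cdf \<mu> (\<xi> j \<omega> - y)\<close>, to which the generating
  functional applies.\<close>

lemma expectation_below_points:
  assumes "real_distribution \<mu>"
  defines "S \<equiv> \<Pi>\<^sub>M j\<in>(UNIV :: nat set). \<mu>"
  shows "((\<lambda>T. exp (- integral {0..T} (\<lambda>t. 1 - cdf \<mu> (t - y)))) \<longlongrightarrow>
    expectation (\<lambda>\<omega>. measure S {X. \<forall>j. X j \<le> \<xi> j \<omega> - y})) at_top"
proof -
  interpret \<mu>: real_distribution \<mu> by fact
  interpret S: sequence_space \<mu>
    using assms(1) by (rule sequence_space_real_distribution)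
  show ?thesis
  proof (rule expectation_prod_points)
    show "mono (\<lambda>t. cdf \<mu> (t - y))"
      by (auto intro!: monoI \<mu>.cdf_nondecreasing)
    show "AE \<omega> in M. (\<lambda>n. \<Prod>j\<le>n. cdf \<mu> (\<xi> j \<omega> - y)) \<longlonglongrightarrow> measure S {X. \<forall>j. X j \<le> \<xi> j \<omega> - y}"
    proof (rule AE_I2)
      fix \<omega>
      show "(\<lambda>n. \<Prod>j\<le>n. cdf \<mu> (\<xi> j \<omega> - y)) \<longlonglongrightarrow> measure S {X. \<forall>j. X j \<le> \<xi> j \<omega> - y}"
        using S.measure_PiM_countable[of "\<lambda>j. {..\<xi> j \<omega> - y}"]
        by (simp add: S_def cdf_def Pi_def)
    qed
    show "(\<lambda>\<omega>. measure S {X. \<forall>j. X j \<le> \<xi> j \<omega> - y}) \<in> borel_measurable M"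
      unfolding S_def using assms(1) by (rule measurable_measure_below_points)
  qed (auto simp: \<mu>.cdf_nonneg \<mu>.cdf_bounded_prob)
qed

text \<open>As \<open>\<mu>\<close> lives on \<open>[0, \<infinity>)\<close>, the shift by \<open>y\<close> contributes exactly \<open>y\<close> to the integral.\<close>

lemma one_minus_cdf_rde_rhs:
  assumes \<mu>: "real_distribution \<mu>" and nonneg: "AE x in \<mu>. 0 \<le> x"
    and C: "((\<lambda>T. exp (- integral {0..T} (\<lambda>t. 1 - cdf \<mu> t))) \<longlongrightarrow> C) at_top"
    and "0 \<le> y"
  shows "1 - cdf (rde_rhs M \<xi> \<mu>) y = C * exp (- y)"
proof -
  interpret \<mu>: real_distribution \<mu> by fact
  interpret R: real_distribution "rde_rhs M \<xi> \<mu>"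
    using \<mu> by (rule real_distribution_rde_rhs)
  have shift: "integral {0..T} (\<lambda>t. 1 - cdf \<mu> (t - x)) = x + integral {0..T - x} (\<lambda>t. 1 - cdf \<mu> t)"
    if "0 \<le> x" "x \<le> T" for x T
  proof -
    have "((\<lambda>t. 1) has_integral x) {0..x}"
      using has_integral_const_real[of "1::real" 0 x] that by simp
    \<comment> \<open>The integrand is 1 except possibly at \<open>t = x\<close>, since
      \<open>\<mu>\<close> may have an atom at 0.\<close>
    then have "((\<lambda>t. 1 - cdf \<mu> (t - x)) has_integral x) {0..x}"
      by (rule has_integral_spike_finite[rotated 2, of _ _ _ "{x}"])
        (auto simp: \<mu>.cdf_eq_0_of_neg[OF nonneg])
    moreover have "((\<lambda>t. 1 - cdf \<mu> t) has_integral integral {0..T - x} (\<lambda>t. 1 - cdf \<mu> t)) {0..T - x}"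
      by (intro integrable_integral antimono_integrable_on_interval)
        (auto simp: monotone_on_def \<mu>.cdf_nondecreasing)
    then have "((\<lambda>t. 1 - cdf \<mu> (t - x)) has_integral integral {0..T - x} (\<lambda>t. 1 - cdf \<mu> t)) {x..T}"
      using has_integral_shift_real_ivl[of _ _ 0 "T - x" "- x"] by fastforce
    ultimately show ?thesis
      using that by (intro integral_unique has_integral_combine[of 0 x T]) auto
  qed
  have tail: "measure (rde_rhs M \<xi> \<mu>) {x..} = C * exp (- x)" if "0 < x" for x
  proof -
    have "filterlim (\<lambda>T. - x + T) at_top at_top"
      by (rule filterlim_tendsto_add_at_top[OF tendsto_const filterlim_ident])
    then have "filterlim (\<lambda>T. T - x) at_top at_top"
      by simp
    then have "((\<lambda>T. exp (- integral {0..T - x} (\<lambda>t. 1 - cdf \<mu> t)) * exp (- x)) \<longlongrightarrow> C * exp (- x)) at_top"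
      by (intro tendsto_intros filterlim_compose[OF C])
    moreover have "eventually (\<lambda>T. exp (- integral {0..T - x} (\<lambda>t. 1 - cdf \<mu> t)) * exp (- x)
        = exp (- integral {0..T} (\<lambda>t. 1 - cdf \<mu> (t - x)))) at_top"
      using eventually_ge_at_top[of x]
      by eventually_elim (use that in \<open>simp add: shift flip: exp_add\<close>)
    ultimately have "((\<lambda>T. exp (- integral {0..T} (\<lambda>t. 1 - cdf \<mu> (t - x)))) \<longlongrightarrow> C * exp (- x)) at_top"
      by (rule Lim_transform_eventually)
    then show ?thesis
      unfolding measure_rde_rhs_atLeast[OF \<mu> that]
      using expectation_below_points[OF \<mu>] by (intro tendsto_unique[OF trivial_limit_at_top_linorder])
  qed
  show ?thesis
    using \<open>0 \<le> y\<close> by (intro R.one_minus_cdf_eqI continuous_intros tail) auto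
qed

text \<open>The limit exists because it is an expectation. No finite mean is assumed: an infinite
  one gives the limit 0.\<close>

lemma ex_limit_exp_integral_cdf:
  assumes "real_distribution \<mu>"
  shows "\<exists>C. ((\<lambda>T. exp (- integral {0..T} (\<lambda>t. 1 - cdf \<mu> t))) \<longlongrightarrow> C) at_top"
  using expectation_below_points[OF assms, of 0] by auto

end

section \<open>The limit constant for special laws, and Lambert's function at 1\<close>

text \<open>The tail integrates to \<open>c\<close>. Thus the map sends the tail constant
  \<open>c\<close> to \<open>exp (- c)\<close>.\<close>

lemma tendsto_exp_integral_exponential_tail:
  fixes F :: "real \<Rightarrow> real"
  assumes "\<And>t. 0 \<le> t \<Longrightarrow> 1 - F t = c * exp (- t)"
  shows "((\<lambda>T. exp (- integral {0..T} (\<lambda>t. 1 - F t))) \<longlongrightarrow> exp (- c)) at_top"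
proof -
  have "integral {0..T} (\<lambda>t. 1 - F t) = c - c * exp (- T)" if "0 \<le> T" for T
  proof (rule integral_unique)
    have "((\<lambda>t. c * exp (- t)) has_integral (- c * exp (- T) - - c * exp (- 0))) {0..T}"
      using that by (intro fundamental_theorem_of_calculus)
        (auto intro!: derivative_eq_intros simp flip: has_real_derivative_iff_has_vector_derivative)
    then show "((\<lambda>t. 1 - F t) has_integral (c - c * exp (- T))) {0..T}"
      using assms by (subst has_integral_cong[where g = "\<lambda>t. c * exp (- t)"]) auto
  qed
  note int = this
  have "eventually (\<lambda>T. exp (- (c - c * exp (- T))) = exp (- integral {0..T} (\<lambda>t. 1 - F t))) at_top"
    using eventually_ge_at_top[of 0] by eventually_elim (simp add: int)
  moreover have "((\<lambda>T::real. exp (- T)) \<longlongrightarrow> 0) at_top"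
    by (rule filterlim_compose[OF exp_at_bot filterlim_uminus_at_bot_at_top])
  then have "((\<lambda>T. exp (- (c - c * exp (- T)))) \<longlongrightarrow> exp (- (c - c * 0))) at_top"
    by (intro tendsto_intros)
  ultimately show ?thesis
    using Lim_transform_eventually by fastforce
qed

lemma inj_on_mult_exp: "inj_on (\<lambda>x::real. x * exp x) {0..}"
proof (rule inj_onI)
  fix x y :: real
  assume "x \<in> {0..}" "y \<in> {0..}" and eq: "x * exp x = y * exp y"
  moreover have "a * exp a < b * exp b" if "0 \<le> a" "a < b" for a b :: real
    using that by (intro mult_strict_mono') auto
  ultimately show "x = y"
    by (metis atLeast_iff less_irrefl linorder_less_linear)
qed

lemma lambert_W_eqI: "0 \<le> x \<Longrightarrow> x * exp x = y \<Longrightarrow> lambert_W y = x"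
  unfolding lambert_W_def using inj_on_mult_exp by (rule the_inv_into_f_eq) auto

text \<open>\<open>lambert_W\<close> is an inverse chosen by \<open>the_inv_into\<close>, so a
  preimage of 1 must be exhibited first; the intermediate value theorem on \<open>{0..1}\<close>
  supplies it.\<close>

lemma lambert_W_1_nonneg: "0 \<le> lambert_W 1"
  and exp_minus_lambert_W_1: "exp (- lambert_W 1) = lambert_W 1"
proof -
  have "\<exists>x\<ge>0. x \<le> 1 \<and> x * exp x = (1::real)"
  proof (rule IVT')
    show "continuous_on {0..1} (\<lambda>x::real. x * exp x)"
      by (intro continuous_intros)
  qed simp_all
  then obtain x :: real where x: "0 \<le> x" "x * exp x = 1"
    by blast
  then have "lambert_W 1 = x" by (intro lambert_W_eqI)
  with x show "0 \<le> lambert_W 1" "exp (- lambert_W 1) = lambert_W 1"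
    by (auto simp: exp_minus field_simps)
qed

text \<open>A point mass at \<open>c\<close> has mean \<open>c\<close>; it serves as a starting law
  whose image has a prescribed tail constant.\<close>

lemma tendsto_exp_integral_cdf_return:
  assumes "0 \<le> c"
  shows "((\<lambda>T. exp (- integral {0..T} (\<lambda>t. 1 - cdf (return borel c) t))) \<longlongrightarrow> exp (- c)) at_top"
proof -
  have cdf: "cdf (return borel c) t = (if c \<le> t then 1 else 0)" for t
    by (simp add: cdf_def measure_return indicator_def)
  have "integral {0..T} (\<lambda>t. 1 - cdf (return borel c) t) = c" if "c \<le> T" for T
  proof (rule integral_unique)
    have "((\<lambda>t. 1::real) has_integral c) {0..c}"
      using has_integral_const_real[of "1::real" 0 c] assms by simp
    then have "((\<lambda>t. 1 - cdf (return borel c) t) has_integral c) {0..c}"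
      by (rule has_integral_spike_finite[rotated 2, of _ _ _ "{c}"]) (auto simp: cdf)
    moreover have "((\<lambda>t. 1 - cdf (return borel c) t) has_integral 0) {c..T}"
      by (rule has_integral_is_0) (auto simp: cdf)
    ultimately show "((\<lambda>t. 1 - cdf (return borel c) t) has_integral c) {0..T}"
      using has_integral_combine[of 0 c T _ c 0] assms that by auto
  qed
  note int = this
  have "eventually (\<lambda>T. exp (- c) = exp (- integral {0..T} (\<lambda>t. 1 - cdf (return borel c) t))) at_top"
    using eventually_ge_at_top[of c] by eventually_elim (simp add: int)
  then show ?thesis
    by (rule Lim_transform_eventually[OF tendsto_const])
qed

section \<open>Existence and uniqueness of the fixed point\<close>

theorem theorem6:
  fixes M :: "'a measure" and \<xi> :: "nat \<Rightarrow> 'a \<Rightarrow> real"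
  assumes "poisson_points M \<xi>"
  shows "\<exists>\<mu>. (\<forall>y. 1 - cdf \<mu> y = (if 0 \<le> y then lambert_W 1 * exp (- y) else 1))
           \<and> rde_solution M \<xi> \<mu>
           \<and> (\<forall>\<nu>. rde_solution M \<xi> \<nu> \<longrightarrow> \<nu> = \<mu>)"
proof -
  interpret poisson_points M \<xi> by fact
  let ?tail = "\<lambda>\<nu>. \<forall>y. 1 - cdf \<nu> y = (if 0 \<le> y then lambert_W 1 * exp (- y) else 1)"
  have tailI: "?tail (rde_rhs M \<xi> \<nu>)"
    if "real_distribution \<nu>" "AE x in \<nu>. 0 \<le> x"
      "((\<lambda>T. exp (- integral {0..T} (\<lambda>t. 1 - cdf \<nu> t))) \<longlongrightarrow> lambert_W 1) at_top" for \<nu>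
    using one_minus_cdf_rde_rhs[OF that]
      real_distribution.cdf_eq_0_of_neg[OF real_distribution_rde_rhs rde_rhs_nonneg, OF that(1) that(1)]
    by simp
  have tail_unique: "\<nu> = \<nu>'" if "real_distribution \<nu>" "real_distribution \<nu>'" "?tail \<nu>" "?tail \<nu>'" for \<nu> \<nu>'
  proof (rule cdf_unique[OF that(1,2)], rule ext)
    fix y
    show "cdf \<nu> y = cdf \<nu>' y"
      using that(3,4)[rule_format, of y] by linarith
  qed
  \<comment> \<open>Taking \<open>\<mu>\<close> as an image avoids building a measure from its
    c.d.f.: that it is a distribution on the nonnegative reals is known for every image.\<close>
  define \<mu> where "\<mu> = rde_rhs M \<xi> (return borel (lambert_W 1))"
  have return: "real_distribution (return borel (lambert_W 1))"
    by (intro real_distribution.intro real_distribution_axioms.intro prob_space_return) simp_all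
  have \<mu>: "real_distribution \<mu>" "AE x in \<mu>. 0 \<le> x"
    unfolding \<mu>_def by (rule real_distribution_rde_rhs[OF return], rule rde_rhs_nonneg[OF return])
  have \<mu>_tail: "?tail \<mu>"
    unfolding \<mu>_def using tendsto_exp_integral_cdf_return[of "lambert_W 1"] lambert_W_1_nonneg exp_minus_lambert_W_1
    by (intro tailI return) (simp_all add: AE_return)
  \<comment> \<open>The mean of \<open>\<mu>\<close> is again \<open>lambert_W 1\<close>, so
    \<open>\<mu>\<close> and its image have the same tail and therefore coincide.\<close>
  have "((\<lambda>T. exp (- integral {0..T} (\<lambda>t. 1 - cdf \<mu> t))) \<longlongrightarrow> exp (- lambert_W 1)) at_top"
    using \<mu>_tail by (intro tendsto_exp_integral_exponential_tail) simp
  then have "?tail (rde_rhs M \<xi> \<mu>)"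
    using \<mu> by (intro tailI) (simp_all add: lambert_W_1_nonneg exp_minus_lambert_W_1)
  then have "\<mu> = rde_rhs M \<xi> \<mu>"
    using \<mu> \<mu>_tail by (intro tail_unique real_distribution_rde_rhs)
  with \<mu> have sol: "rde_solution M \<xi> \<mu>"
    by (simp add: rde_solution_def)
  have "\<nu> = \<mu>" if "rde_solution M \<xi> \<nu>" for \<nu>
  proof -
    have \<nu>: "real_distribution \<nu>" "AE x in \<nu>. 0 \<le> x" and fixpoint: "\<nu> = rde_rhs M \<xi> \<nu>"
      using that by (auto simp: rde_solution_def)
    obtain C where C: "((\<lambda>T. exp (- integral {0..T} (\<lambda>t. 1 - cdf \<nu> t))) \<longlongrightarrow> C) at_top"
      using ex_limit_exp_integral_cdf[OF \<nu>(1)] by blast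
    have "1 - cdf \<nu> y = C * exp (- y)" if "0 \<le> y" for y
      using one_minus_cdf_rde_rhs[OF \<nu> C that] fixpoint by simp
    then have "((\<lambda>T. exp (- integral {0..T} (\<lambda>t. 1 - cdf \<nu> t))) \<longlongrightarrow> exp (- C)) at_top"
      by (rule tendsto_exp_integral_exponential_tail)
    \<comment> \<open>Being an image, \<open>\<nu>\<close> has tail constant \<open>C\<close>, so
      the same function of \<open>T\<close> has both limits. This also excludes
      \<open>C = 0\<close>, the case of infinite mean.\<close>
    then have "C = exp (- C)"
      using C by (intro tendsto_unique[OF trivial_limit_at_top_linorder])
    then have "0 \<le> C" "C * exp C = 1"
      by (metis exp_ge_zero, metis exp_minus_inverse mult.commute)
    then have "C = lambert_W 1"
      using lambert_W_eqI by metis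
    with C have "?tail (rde_rhs M \<xi> \<nu>)"
      by (intro tailI \<nu>) simp
    then have "?tail \<nu>"
      using fixpoint by simp
    then show ?thesis
      using \<nu>(1) \<mu>(1) \<mu>_tail by (intro tail_unique)
  qed
  with sol \<mu>_tail show ?thesis by blast
qed

end
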